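(* Let $r\geq 2$ be an integer and let $H$ be an $r$-uniform hypergraph with $e$ edges. Then its spectral radius satisfies $\rho(H)\leq f_r(e)$. Equality holds if and only if $e={k\choose r}$ for some integer $k$ and $H$ is the complete $r$-uniform hypergraph $K_k^r$ together with possibly some isolated vertices.
   Context: An $r$-uniform hypergraph $H$ consists of a finite vertex set $V=\{1,\dots,n\}$ and an edge set $E\subseteq {V\choose r}$ (each edge is an $r$-element subset of $V$). Its spectral radius is $\rho(H)=\max_{\mathbf{x}\in\mathbb{R}^n,\ \Vert \mathbf{x}\Vert_r=1} r\sum_{\{i_1,\dots,i_r\}\in E} x_{i_1}\cdots x_{i_r}$, where $\Vert\mathbf{x}\Vert_r=(\sum_i |x_i|^r)^{1/r}$; equivalently it is the spectral radius of the adjacency tensor $A=(a_{i_1\cdots i_r})$ with $a_{i_1\cdots i_r}=1/(r-1)!$ if $\{i_1,\dots,i_r\}\in E$ and $0$ otherwise. $K_k^r$ denotes the hypergraph on $k$ vertices whose edges are all $r$-subsets. For a positive integer $m$ let $p_m(x)=\frac{x(x-1)\cdots(x-m+1)}{m!}$ (so ${x\choose m}=p_m(x)$ for real $x$); $p_r$ is increasing on $[r-1,\infty)$, and $p_r^{-1}\colon[0,\infty)\to[r-1,\infty)$ denotes the inverse of its restriction to that interval. Define $f_r(x)=p_{r-1}(p_r^{-1}(x)-1)$, so that $f_r({k\choose r})={k-1\choose r-1}$ for $k\geq r-1$ (e.g. $f_2(e)=\frac{\sqrt{8e+1}-1}{2}$). *)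

theory Defs
  imports "HOL-Analysis.Analysis" "HOL-Library.Ramsey"
begin

definition uniform_hypergraph :: "nat \<Rightarrow> 'a set \<Rightarrow> 'a set set \<Rightarrow> bool" where
  "uniform_hypergraph r V E \<longleftrightarrow> finite V \<and> E \<subseteq> [V]\<^bsup>r\<^esup>"

text \<open>
  Vectors indexed by the vertex set are functions \<open>x :: 'a \<Rightarrow> real\<close>; only the values on \<open>V\<close> matter
  in the following three definitions (as long as the edges are subsets of \<open>V\<close>).
\<close>

definition lnorm :: "nat \<Rightarrow> 'a set \<Rightarrow> ('a \<Rightarrow> real) \<Rightarrow> real" where
  "lnorm r V x = root r (\<Sum>i\<in>V. \<bar>x i\<bar> ^ r)"

definition edge_form :: "nat \<Rightarrow> 'a set set \<Rightarrow> ('a \<Rightarrow> real) \<Rightarrow> real" where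
  "edge_form r E x = real r * (\<Sum>e\<in>E. \<Prod>i\<in>e. x i)"

text \<open>
  \<^const>\<open>Greatest\<close> is the maximum, which is attained by \<open>hyp_spectral_radius_attained\<close> below
  whenever \<open>V\<close> is nonempty; for empty \<open>V\<close> there is no vector of norm 1 and the value is unspecified.
\<close>

definition hyp_spectral_radius :: "nat \<Rightarrow> 'a set \<Rightarrow> 'a set set \<Rightarrow> real" where
  "hyp_spectral_radius r V E = (GREATEST t. \<exists>x. lnorm r V x = 1 \<and> t = edge_form r E x)"

definition complete_with_isolated :: "nat \<Rightarrow> nat \<Rightarrow> 'a set \<Rightarrow> 'a set set \<Rightarrow> bool" where
  "complete_with_isolated r k V E \<longleftrightarrow> (\<exists>S\<subseteq>V. card S = k \<and> E = [S]\<^bsup>r\<^esup>)"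

text \<open>The polynomial $p_m(x)$ is \<open>x gchoose m\<close>.\<close>

definition p_inv :: "nat \<Rightarrow> real \<Rightarrow> real" where
  "p_inv r = the_inv_into {real r - 1..} (\<lambda>x. x gchoose r)"

definition f_fun :: "nat \<Rightarrow> real \<Rightarrow> real" where
  "f_fun r x = (p_inv r x - 1) gchoose (r - 1)"


lemma gchoose_strict_mono_on:
  assumes "r \<ge> 1"
  shows "strict_mono_on {real r - 1..} (\<lambda>x::real. x gchoose r)"
proof (rule strict_mono_onI)
  fix x y :: real
  assume xy: "x \<in> {real r - 1..}" "y \<in> {real r - 1..}" "x < y"
  obtain q where q: "r = Suc q" using assms by (cases r) auto
  have "(\<Prod>i=0..<q. x - real i) * (x - real q) < (\<Prod>i=0..<q. y - real i) * (y - real q)"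
  proof (rule mult_le_less_imp_less)
    show "(\<Prod>i=0..<q. x - real i) \<le> (\<Prod>i=0..<q. y - real i)"
      using xy q by (intro prod_mono) auto
    have "x - real i > 0" if "i < q" for i using that xy q by auto
    then show "0 < (\<Prod>i=0..<q. x - real i)" by (intro prod_pos) auto
  qed (use xy q in auto)
  then show "x gchoose r < y gchoose r"
    by (simp add: gbinomial_prod_rev q divide_strict_right_mono del: fact_Suc)
qed

lemma bij_betw_gchoose:
  assumes "r \<ge> 1"
  shows "bij_betw (\<lambda>x::real. x gchoose r) {real r - 1..} {0..}"
proof -
  have sm: "strict_mono_on {real r - 1..} (\<lambda>x::real. x gchoose r)"
    using gchoose_strict_mono_on[OF assms] .
  have z: "(real r - 1) gchoose r = 0"
    using assms binomial_gbinomial[of "r - 1" r, where 'a = real] by (simp add: of_nat_diff binomial_eq_0)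
  have cont: "continuous_on A (\<lambda>x::real. x gchoose r)" for A
    unfolding gbinomial_prod_rev by (intro continuous_intros) auto
  have "\<exists>x\<ge>real r - 1. x gchoose r = y" if "y \<ge> 0" for y :: real
  proof -
    define b where "b = real r - 1 + (fact r * y + 1)"
    have b: "b \<ge> real r - 1" using mult_nonneg_nonneg[OF fact_ge_zero that, of r] by (simp add: b_def)
    obtain q where q: "r = Suc q" using assms by (cases r) auto
    have "(\<Prod>i=0..<q. 1) \<le> (\<Prod>i=0..<q. b - real i)"
    proof (rule prod_mono)
      fix i assume i: "i \<in> {0..<q}"
      have "fact r * y \<ge> 0" using that by simp
      then show "0 \<le> (1::real) \<and> 1 \<le> b - real i" using i q by (simp add: b_def del: fact_Suc)
    qed
    then have "1 * (fact r * y + 1) \<le> (\<Prod>i=0..<q. b - real i) * (b - real q)"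
      using that q by (intro mult_mono) (auto simp: b_def simp del: fact_Suc)
    then have "fact r * y \<le> fact r * (b gchoose r)"
      unfolding gbinomial_mult_fact by (simp add: q)
    then have "y \<le> b gchoose r" by simp
    then show ?thesis
      using IVT'[of "\<lambda>x. x gchoose r" "real r - 1" y b] z that b cont by auto
  qed
  moreover have "x gchoose r \<ge> 0" if "x \<ge> real r - 1" for x :: real
    using strict_mono_on_leD[OF sm, of "real r - 1" x] that z by simp
  ultimately show ?thesis
    using strict_mono_on_imp_inj_on[OF sm] by (auto simp: bij_betw_def image_iff)
qed

lemma p_inv_gchoose:
  assumes "r \<ge> 1" "x \<ge> real r - 1"
  shows "p_inv r (x gchoose r) = x"
  unfolding p_inv_def
  using assms strict_mono_on_imp_inj_on[OF gchoose_strict_mono_on[OF assms(1)]]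
  by (subst the_inv_into_f_f) auto

lemma f_fun_binomial:
  assumes "r \<ge> 2" "k \<ge> r - 1"
  shows "f_fun r (real (k choose r)) = real ((k - 1) choose (r - 1))"
proof -
  have "p_inv r (real k gchoose r) = real k"
    using assms by (intro p_inv_gchoose) auto
  then show ?thesis
    using assms by (simp add: f_fun_def binomial_gbinomial of_nat_diff)
qed

lemma hyp_spectral_radius_attained:
  assumes H: "uniform_hypergraph r V E" and V: "V \<noteq> {}" and r: "r \<ge> 1"
  shows "\<exists>x. lnorm r V x = 1 \<and> hyp_spectral_radius r V E = edge_form r E x"
    and "\<And>x. lnorm r V x = 1 \<Longrightarrow> edge_form r E x \<le> hyp_spectral_radius r V E"
proof -
  have fV: "finite V" and EV: "\<And>e. e \<in> E \<Longrightarrow> e \<subseteq> V"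
    using H by (auto simp: uniform_hypergraph_def nsets_def)
  define B :: "('a \<Rightarrow> real) set" where "B = (\<Pi>\<^sub>E i\<in>UNIV. if i \<in> V then {-1..1} else {0})"
  define K where "K = B \<inter> {x. lnorm r V x = 1}"
  have "compactin (product_topology (\<lambda>i::'a. euclidean :: real topology) UNIV) B"
    unfolding B_def by (subst compactin_PiE) auto
  then have cB: "compact B" by (simp add: euclidean_product_topology)
  have cl: "continuous_on UNIV (lnorm r V)"
    unfolding lnorm_def[abs_def]
    by (intro continuous_intros continuous_on_product_coordinates)
  have "closed {x. lnorm r V x = 1}"
    using continuous_closed_preimage_constant[OF cl closed_UNIV, of 1] by simp
  then have cK: "compact K" unfolding K_def using cB by (rule compact_Int_closed[rotated])
  have ce: "continuous_on K (edge_form r E)"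
    unfolding edge_form_def[abs_def]
    by (intro continuous_intros continuous_on_subset[OF continuous_on_product_coordinates]) auto
  have red: "\<exists>y\<in>K. edge_form r E y = edge_form r E x" if x: "lnorm r V x = 1" for x
  proof (rule bexI)
    let ?y = "\<lambda>i. if i \<in> V then x i else 0"
    show "edge_form r E ?y = edge_form r E x"
      unfolding edge_form_def using EV by (intro arg_cong[where f = "(*) (real r)"] sum.cong prod.cong) auto
    have s: "(\<Sum>i\<in>V. \<bar>x i\<bar> ^ r) = 1" using x r by (simp add: lnorm_def)
    have "\<bar>x i\<bar> \<le> 1" if "i \<in> V" for i
    proof -
      have "\<bar>x i\<bar> ^ r \<le> (\<Sum>i\<in>V. \<bar>x i\<bar> ^ r)" using that fV by (intro member_le_sum) auto
      then have "\<bar>x i\<bar> ^ r \<le> 1" using s by simp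
      then show ?thesis using r by (simp add: power_le_one_iff)
    qed
    then show "?y \<in> K"
      using x by (auto simp: K_def B_def lnorm_def abs_le_iff PiE_iff minus_le_iff cong: sum.cong)
  qed
  obtain v where v: "v \<in> V" using V by auto
  have "lnorm r V (\<lambda>i. if i = v then 1 else 0) = 1"
    using r v fV by (simp add: lnorm_def if_distrib[of abs] if_distrib[of "\<lambda>a. a ^ r"] power_0_left cong: if_cong)
  then have "K \<noteq> {}" using red by blast
  then obtain x where x: "x \<in> K" "\<And>y. y \<in> K \<Longrightarrow> edge_form r E y \<le> edge_form r E x"
    using continuous_attains_sup[OF cK _ ce] by blast
  have x1: "lnorm r V x = 1" using x by (simp add: K_def)
  have le: "edge_form r E y \<le> edge_form r E x" if "lnorm r V y = 1" for y
    using red[OF that] x by metis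
  have eq: "hyp_spectral_radius r V E = edge_form r E x"
    unfolding hyp_spectral_radius_def by (rule Greatest_equality) (use x1 le in auto)
  show "\<exists>x. lnorm r V x = 1 \<and> hyp_spectral_radius r V E = edge_form r E x" using x1 eq by blast
  show "\<And>x. lnorm r V x = 1 \<Longrightarrow> edge_form r E x \<le> hyp_spectral_radius r V E" using le eq by simp
qed

end

theory Submission
  imports Defs "HOL-Combinatorics.Multiset_Permutations"
begin

text \<open>
  An optimal vector \<open>x\<close>, which may be taken nonnegative, makes a random ordered edge
  \<open>(X\<^sub>1, \<dots>, X\<^sub>r)\<close> with probability proportional to the product of the entries of \<open>x\<close>. If \<open>H\<^sub>k\<close> is
  the entropy of \<open>k\<close> of its coordinates, Gibbs' inequality gives \<open>(r-1)! \<rho> \<le> exp (H\<^sub>r - H\<^sub>1)\<close>, while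
  \<open>exp H\<^sub>r \<le> r! e\<close> since there are only \<open>r! e\<close> ordered edges. The numbers
  \<open>z\<^sub>k = exp (H\<^sub>k\<^sub>+\<^sub>1 - H\<^sub>k)\<close> satisfy \<open>z\<^sub>k \<ge> z\<^sub>k\<^sub>+\<^sub>1 + 1\<close>. Writing \<open>r! e = y (y-1) \<cdots> (y-r+1)\<close>, either
  \<open>z\<^sub>0 \<le> y\<close>, hence \<open>z\<^sub>k \<le> y - k\<close> for all \<open>k\<close>, or \<open>z\<^sub>0 > y\<close>; in both cases
  \<open>z\<^sub>1 \<cdots> z\<^sub>r\<^sub>-\<^sub>1 \<le> (y-1) \<cdots> (y-r+1)\<close>, which is the bound. Equality forces \<open>z\<^sub>k = z\<^sub>k\<^sub>+\<^sub>1 + 1\<close> throughout,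
  and then \<open>T \<union> {a, b}\<close> lies in an edge whenever \<open>T \<union> {a}\<close> and \<open>T \<union> {b}\<close> do, so all \<open>r\<close>-sets of
  vertices covered by edges are edges.
\<close>

section \<open>Gibbs' inequality and its equality case\<close>

lemma diff_le_mult_ln_divide:
  fixes A B :: real
  assumes "A \<ge> 0" "B \<ge> 0" "A > 0 \<Longrightarrow> B > 0"
  shows "A - B \<le> A * ln (A / B)"
    and "A * ln (A / B) = A - B \<Longrightarrow> A = B"
proof -
  have *: "A - B - A * ln (A / B) = A * (ln (B / A) - (B / A - 1))" if "A > 0"
    using that assms by (simp add: ln_div field_simps)
  have le: "ln (B / A) \<le> B / A - 1" if "A > 0"
    using that assms by (intro ln_le_minus_one) auto
  show "A - B \<le> A * ln (A / B)"
  proof (cases "A > 0")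
    case True
    have "A * (ln (B / A) - (B / A - 1)) \<le> 0"
      using le[OF True] True by (intro mult_nonneg_nonpos) auto
    then show ?thesis using *[OF True] by linarith
  qed (use assms in auto)
  assume eq: "A * ln (A / B) = A - B"
  show "A = B"
  proof (cases "A > 0")
    case True
    then have "ln (B / A) = B / A - 1" using eq * by auto
    then have "B / A = 1" using True assms by (intro ln_eq_minus_one) auto
    then show ?thesis using True by simp
  qed (use assms eq in auto)
qed

text \<open>Gibbs' inequality follows by summing the bound \<open>ln t \<le> t - 1\<close> at
  \<open>t = B i / A i\<close>. The termwise slacks \<open>D i\<close> are nonnegative, so a
  vanishing sum makes each of them vanish.\<close>

lemma relative_entropy_nonneg:
  fixes A B :: "'i \<Rightarrow> real"
  assumes "finite I" "\<And>i. i \<in> I \<Longrightarrow> A i \<ge> 0" "\<And>i. i \<in> I \<Longrightarrow> B i \<ge> 0"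
    "\<And>i. i \<in> I \<Longrightarrow> A i > 0 \<Longrightarrow> B i > 0" "sum B I \<le> sum A I"
  shows "(\<Sum>i\<in>I. A i * ln (A i / B i)) \<ge> 0"
    and "(\<Sum>i\<in>I. A i * ln (A i / B i)) = 0 \<Longrightarrow> i \<in> I \<Longrightarrow> A i = B i"
proof -
  have le: "A i - B i \<le> A i * ln (A i / B i)" if "i \<in> I" for i
    using assms that by (intro diff_le_mult_ln_divide) auto
  have "(\<Sum>i\<in>I. A i - B i) \<le> (\<Sum>i\<in>I. A i * ln (A i / B i))"
    using le by (intro sum_mono)
  then show "(\<Sum>i\<in>I. A i * ln (A i / B i)) \<ge> 0" using assms(5) by (simp add: sum_subtractf)
  assume eq: "(\<Sum>i\<in>I. A i * ln (A i / B i)) = 0" and i: "i \<in> I"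
  define D where "D i = A i * ln (A i / B i) - (A i - B i)" for i
  have nn: "D i \<ge> 0" if "i \<in> I" for i
    using le[OF that] by (simp add: D_def)
  have "sum D I \<le> 0"
    using eq assms(5) by (simp add: D_def sum_subtractf)
  then have "sum D I = 0"
    using sum_nonneg[of I D] nn by simp
  then have "A i * ln (A i / B i) = A i - B i"
    using sum_nonneg_eq_0_iff[of I D] assms(1) nn i by (simp add: D_def)
  then show "A i = B i" by (rule diff_le_mult_ln_divide(2)[rotated 3]) (use assms i in auto)
qed

text \<open>Let \<open>v\<close> be a symmetric law of total mass \<open>s\<close> on pairs
  \<open>(a, b)\<close>, with marginal \<open>u\<close>. Then \<open>A\<close> is the law after
  \<open>a\<close> is replaced by \<open>b\<close> with probability \<open>p\<close>, and both its
  marginals are again \<open>u\<close>. The expression is the relative entropy of \<open>A\<close>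
  with respect to the product law \<open>u a * u b / s\<close>, so it vanishes only under
  independence.\<close>

lemma mixture_relative_entropy:
  fixes u :: "'a \<Rightarrow> real" and v :: "'a \<Rightarrow> 'a \<Rightarrow> real" and p s :: real
  defines "A \<equiv> \<lambda>a b. (1 - p) * v a b + (if a = b then p * u b else 0)"
  assumes V: "finite V" and v0: "\<And>a b. v a b \<ge> 0" and sym: "\<And>a b. v a b = v b a"
    and diag: "\<And>a. v a a = 0" and p: "0 < p" "p < 1"
    and mu: "\<And>b. b \<in> V \<Longrightarrow> (\<Sum>a\<in>V. v a b) = u b" and ms: "(\<Sum>b\<in>V. u b) = s"
  shows "s * (p * ln p + (1 - p) * ln (1 - p)) + s * ln s - (2 - p) * (\<Sum>b\<in>V. u b * ln (u b))
      + (1 - p) * (\<Sum>b\<in>V. \<Sum>a\<in>V. v a b * ln (v a b)) \<ge> 0"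
    and "s * (p * ln p + (1 - p) * ln (1 - p)) + s * ln s - (2 - p) * (\<Sum>b\<in>V. u b * ln (u b))
      + (1 - p) * (\<Sum>b\<in>V. \<Sum>a\<in>V. v a b * ln (v a b)) = 0 \<Longrightarrow>
      a \<in> V \<Longrightarrow> b \<in> V \<Longrightarrow> A a b = u a * u b / s"
proof -
  let ?L = "s * (p * ln p + (1 - p) * ln (1 - p)) + s * ln s - (2 - p) * (\<Sum>b\<in>V. u b * ln (u b))
      + (1 - p) * (\<Sum>b\<in>V. \<Sum>a\<in>V. v a b * ln (v a b))"
  define B where "B = (\<lambda>a b. u a * u b / s)"
  have u0: "u b \<ge> 0" if "b \<in> V" for b using mu[OF that] v0 by (metis sum_nonneg)
  have s0: "s \<ge> 0" using ms u0 by (metis sum_nonneg)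
  have spos: "s > 0" if "b \<in> V" "u b > 0" for b
    using member_le_sum[of b V u] that u0 V ms by auto
  have upos: "u b > 0" if "a \<in> V" "b \<in> V" "v a b > 0" for a b
    using member_le_sum[of a V "\<lambda>a. v a b"] that v0 V mu[OF that(2)] by auto
  have mu': "(\<Sum>b\<in>V. v a b) = u a" if "a \<in> V" for a
    using mu[OF that] by (subst sym)
  have A0: "A a b \<ge> 0" if "a \<in> V" "b \<in> V" for a b
    using v0 u0 that p by (simp add: A_def)
  have B0: "B a b \<ge> 0" if "a \<in> V" "b \<in> V" for a b
    using s0 u0 that by (simp add: B_def)
  have AB: "B a b > 0" if ab: "a \<in> V" "b \<in> V" "A a b > 0" for a b
  proof (cases "a = b")
    case True
    then have "u b > 0" using ab p diag u0[of b] by (auto simp: A_def zero_less_mult_iff)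
    then show ?thesis using True spos ab by (auto simp: B_def)
  next
    case False
    then have "v a b > 0" using ab p v0[of a b] by (auto simp: A_def zero_less_mult_iff)
    then have "u b > 0" "u a > 0" using upos[of a b] upos[of b a] ab sym[of a b] by auto
    then show ?thesis using spos ab by (auto simp: B_def)
  qed
  have sumA: "(\<Sum>b\<in>V. \<Sum>a\<in>V. A a b) = s"
    using V by (simp add: A_def sum.distrib mu ms flip: sum_distrib_left) (simp add: algebra_simps)
  have sumB: "(\<Sum>b\<in>V. \<Sum>a\<in>V. B a b) = s"
  proof -
    have "(\<Sum>b\<in>V. \<Sum>a\<in>V. B a b) = (\<Sum>b\<in>V. u b) * (\<Sum>a\<in>V. u a) / s"
      by (simp add: B_def sum_product sum_divide_distrib mult.commute)
    then show ?thesis using ms by simp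
  qed
  \<comment> \<open>Since \<open>v a a = 0\<close>, the two summands of \<open>A\<close> have
    disjoint supports, so the logarithm splits separately on and off the diagonal. Zero masses are
    treated apart because \<open>ln\<close> of a product or quotient is expanded only for positive
    factors.\<close>
  have pointwise: "A a b * ln (A a b / B a b) =
      (if a = b then p * (u b * ln p + u b * ln s - u b * ln (u b)) else 0) +
      (1 - p) * (v a b * ln (1 - p) + v a b * ln (v a b) + v a b * ln s
        - v a b * ln (u a) - v a b * ln (u b))" if ab: "a \<in> V" "b \<in> V" for a b
  proof (cases "a = b")
    case True
    show ?thesis
    proof (cases "u b = 0")
      case False
      then have "u b > 0" using u0 ab by force
      then show ?thesis using True p spos[OF ab(2)]
        by (simp add: A_def B_def diag ln_div ln_mult algebra_simps)
    qed (use True in \<open>simp add: A_def diag\<close>)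
  next
    case ne: False
    show ?thesis
    proof (cases "v a b = 0")
      case False
      then have v: "v a b > 0" using v0[of a b] by simp
      then have "u b > 0" "u a > 0" using upos[of a b] upos[of b a] ab sym[of a b] by auto
      then have "ln (A a b / B a b) = ln (1 - p) + ln (v a b) + ln s - ln (u a) - ln (u b)"
        using v ne p spos[OF ab(2)] by (simp add: A_def B_def ln_div ln_mult)
      then have "A a b * ln (A a b / B a b) =
          (1 - p) * v a b * (ln (1 - p) + ln (v a b) + ln s - ln (u a) - ln (u b))"
        using ne by (simp add: A_def)
      then show ?thesis using ne by (simp add: algebra_simps)
    qed (use ne in \<open>simp add: A_def\<close>)
  qed
  have vu: "(\<Sum>b\<in>V. \<Sum>a\<in>V. v a b * ln (u a)) = (\<Sum>a\<in>V. u a * ln (u a))"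
    by (subst sum.swap) (simp add: mu' flip: sum_distrib_right)
  have "(\<Sum>b\<in>V. \<Sum>a\<in>V. A a b * ln (A a b / B a b)) = ?L"
    using V by (simp add: pointwise sum.distrib sum_subtractf mu ms vu flip: sum_distrib_right sum_distrib_left)
      (simp add: algebra_simps)
  then have eq: "(\<Sum>(b,a)\<in>V \<times> V. A a b * ln (A a b / B a b)) = ?L"
    by (simp add: sum.cartesian_product)
  have sums: "(\<Sum>(b,a)\<in>V \<times> V. B a b) \<le> (\<Sum>(b,a)\<in>V \<times> V. A a b)"
    using sumA sumB by (simp flip: sum.cartesian_product)
  note G = relative_entropy_nonneg[of "V \<times> V" "\<lambda>(b,a). A a b" "\<lambda>(b,a). B a b"]
  show "?L \<ge> 0"
    using G(1) V A0 B0 AB sums eq by (auto simp: case_prod_beta')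
  show "A a b = u a * u b / s" if "?L = 0" "a \<in> V" "b \<in> V"
    using G(2)[of "(b,a)"] V A0 B0 AB sums eq that by (auto simp: case_prod_beta' B_def)
qed

section \<open>Entropy of exchangeable tuples\<close>

definition tuples :: "'a set \<Rightarrow> nat \<Rightarrow> 'a list set" where
  "tuples V k = {xs. set xs \<subseteq> V \<and> length xs = k}"

lemma tuples_0 [simp]: "tuples V 0 = {[]}"
  by (auto simp: tuples_def)

lemma finite_tuples: "finite V \<Longrightarrow> finite (tuples V k)"
  unfolding tuples_def by (rule finite_lists_length_eq)

lemma sum_tuples_Suc:
  assumes "finite V"
  shows "(\<Sum>xs\<in>tuples V (Suc k). g xs) = (\<Sum>xs\<in>tuples V k. \<Sum>a\<in>V. g (a # xs))"
proof -
  have "(\<Sum>xs\<in>tuples V (Suc k). g xs) = (\<Sum>(xs, a)\<in>tuples V k \<times> V. g (a # xs))"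
    by (rule sum.reindex_bij_witness[of _ "\<lambda>(xs, a). a # xs" "\<lambda>xs. (tl xs, hd xs)"])
      (auto simp: tuples_def length_Suc_conv)
  then show ?thesis by (simp add: sum.cartesian_product)
qed

text \<open>
  \<open>q xs\<close> is the probability that an exchangeable random \<open>r\<close>-tuple of distinct vertices ends
  with \<open>xs\<close>.
\<close>

locale exchangeable_tuples =
  fixes V :: "'a set" and r :: nat and q :: "'a list \<Rightarrow> real"
  assumes V: "finite V"
    and nonneg: "q xs \<ge> 0"
    and empty: "q [] = 1"
    and marginal: "\<lbrakk>set xs \<subseteq> V; length xs < r\<rbrakk> \<Longrightarrow> (\<Sum>a\<in>V. q (a # xs)) = q xs"
    and swap: "q (a # b # xs) = q (b # a # xs)"
    and no_repeat: "q (a # a # xs) = 0"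
begin

definition ent :: "nat \<Rightarrow> real" where
  "ent k = - (\<Sum>xs\<in>tuples V k. q xs * ln (q xs))"

lemma total: "k \<le> r \<Longrightarrow> (\<Sum>xs\<in>tuples V k. q xs) = 1"
proof (induction k)
  case (Suc k)
  have "(\<Sum>xs\<in>tuples V (Suc k). q xs) = (\<Sum>xs\<in>tuples V k. q xs)"
    unfolding sum_tuples_Suc[OF V]
    by (rule sum.cong) (use Suc.prems in \<open>auto simp: tuples_def marginal\<close>)
  then show ?case using Suc by simp
qed (simp add: empty)

text \<open>
  Replace the leading vertex of the tuple \<open>(a, b, T)\<close> by \<open>b\<close> with probability \<open>p\<close>. Exchangeability
  makes the result distributed like \<open>(a, T)\<close>, while given \<open>(b, T)\<close> the coin can be recovered from
  it because \<open>a \<noteq> b\<close>. The best \<open>p\<close> turns the resulting entropy inequality into the one stated.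
\<close>

lemma exp_ent_step:
  assumes k: "Suc k < r"
  shows "exp (ent (Suc (Suc k)) - ent (Suc k)) + 1 \<le> exp (ent (Suc k) - ent k)"
    and "\<lbrakk>exp (ent (Suc (Suc k)) - ent (Suc k)) + 1 = exp (ent (Suc k) - ent k);
      xs \<in> tuples V k; a \<in> V; b \<in> V; a \<noteq> b; q (a # xs) > 0; q (b # xs) > 0\<rbrakk>
      \<Longrightarrow> q (a # b # xs) > 0"
proof -
  define X where "X = exp (ent (Suc (Suc k)) - ent (Suc k))"
  \<comment> \<open>This \<open>p\<close> maximises the entropy of the coin plus
    \<open>(1 - p) * ln X\<close>; by \<open>h\<close> the maximum is
    \<open>ln (1 + X)\<close>.\<close>
  define p where "p = 1 / (1 + X)"
  have X: "X > 0" by (simp add: X_def)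
  have p: "0 < p" "p < 1" using X by (auto simp: p_def)
  have p1: "1 - p = X / (1 + X)" using X by (simp add: p_def field_simps)
  have h: "p * ln p + (1 - p) * ln (1 - p) - (1 - p) * ln X = - ln (1 + X)"
  proof -
    have "ln p = - ln (1 + X)" "ln (1 - p) = ln X - ln (1 + X)"
      unfolding p1 using X by (simp_all add: p_def ln_div)
    then show ?thesis by (simp only:) (simp add: algebra_simps)
  qed
  \<comment> \<open>\<open>L xs\<close> is the relative entropy of the mixture when the tail is
    fixed to \<open>xs\<close>. Summing over \<open>xs\<close> amounts to conditioning on the
    tail.\<close>
  define L where "L xs = q xs * (p * ln p + (1 - p) * ln (1 - p)) + q xs * ln (q xs)
      - (2 - p) * (\<Sum>b\<in>V. q (b # xs) * ln (q (b # xs)))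
      + (1 - p) * (\<Sum>b\<in>V. \<Sum>a\<in>V. q (a # b # xs) * ln (q (a # b # xs)))" for xs
  note mix = mixture_relative_entropy[where v = "\<lambda>a b. q (a # b # xs)" and u = "\<lambda>b. q (b # xs)"
    and s = "q xs" and p = p for xs, OF V nonneg swap no_repeat p]
  have m: "\<And>b. b \<in> V \<Longrightarrow> (\<Sum>a\<in>V. q (a # b # xs)) = q (b # xs)" "(\<Sum>b\<in>V. q (b # xs)) = q xs"
    if "xs \<in> tuples V k" for xs
    using that k by (auto simp: tuples_def marginal)
  have L0: "L xs \<ge> 0" if "xs \<in> tuples V k" for xs
    unfolding L_def using m[OF that] by (intro mix(1))
  have "(\<Sum>xs\<in>tuples V k. L xs) = (p * ln p + (1 - p) * ln (1 - p)) - ent k + (2 - p) * ent (Suc k)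
      - (1 - p) * ent (Suc (Suc k))"
    unfolding ent_def L_def sum_tuples_Suc[OF V] using k
    by (simp add: sum.distrib sum_subtractf total flip: sum_distrib_left sum_distrib_right)
  also have "\<dots> = (ent (Suc k) - ent k) - ln (1 + X)"
    using h by (simp add: X_def algebra_simps)
  finally have sumL: "(\<Sum>xs\<in>tuples V k. L xs) = (ent (Suc k) - ent k) - ln (1 + X)" .
  then have "ln (1 + X) \<le> ent (Suc k) - ent k" using sum_nonneg[of "tuples V k" L] L0 by simp
  then have "1 + X \<le> exp (ent (Suc k) - ent k)" using X by (metis add_pos_pos exp_le_cancel_iff exp_ln zero_less_one)
  then show "exp (ent (Suc (Suc k)) - ent (Suc k)) + 1 \<le> exp (ent (Suc k) - ent k)"
    by (simp add: X_def add.commute)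
  assume eq: "exp (ent (Suc (Suc k)) - ent (Suc k)) + 1 = exp (ent (Suc k) - ent k)"
    and xs: "xs \<in> tuples V k" and ab: "a \<in> V" "b \<in> V" "a \<noteq> b" "q (a # xs) > 0" "q (b # xs) > 0"
  have "ent (Suc k) - ent k = ln (1 + X)"
    using arg_cong[OF eq, of ln] by (simp add: X_def add.commute)
  then have "(\<Sum>xs\<in>tuples V k. L xs) = 0" using sumL by simp
  then have "L xs = 0" using sum_nonneg_eq_0_iff[OF finite_tuples[OF V], of k L] L0 xs by blast
  \<comment> \<open>Equality forces independence given the tail. As \<open>a \<noteq> b\<close>,
    only the unreplaced pair contributes to the mixture at \<open>(a, b)\<close>.\<close>
  then have "(1 - p) * q (a # b # xs) = q (a # xs) * q (b # xs) / q xs"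
    using mix(2)[of xs a b] m[OF xs] ab by (simp add: L_def)
  moreover have "q xs > 0"
    using member_le_sum[of a V "\<lambda>a. q (a # xs)"] m(2)[OF xs] ab nonneg V by fastforce
  ultimately have "(1 - p) * q (a # b # xs) > 0" using ab by simp
  then show "q (a # b # xs) > 0" using p by (simp add: zero_less_mult_iff)
qed

lemma exp_ent_eq_prod: "exp (ent k) = (\<Prod>i<k. exp (ent (Suc i) - ent i))"
proof -
  have "(\<Sum>i<k. ent (Suc i) - ent i) = ent k - ent 0" by (rule sum_lessThan_telescope)
  also have "ent 0 = 0" by (simp add: ent_def empty)
  finally show ?thesis by (simp flip: exp_sum)
qed

text \<open>Gibbs' inequality against the uniform distribution on the support of \<open>q\<close>
  bounds the entropy by the logarithm of the size of the support.\<close>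

lemma exp_ent_le_card:
  assumes D: "finite D" "\<And>xs. xs \<in> tuples V r \<Longrightarrow> q xs > 0 \<Longrightarrow> xs \<in> D"
  shows "exp (ent r) \<le> real (card D)"
proof -
  let ?S = "{xs \<in> tuples V r. q xs > 0}"
  have fin: "finite ?S" using finite_tuples[OF V] by simp
  have S: "(\<Sum>xs\<in>?S. g xs) = (\<Sum>xs\<in>tuples V r. g xs)"
    if "\<And>xs. q xs = 0 \<Longrightarrow> g xs = 0" for g :: "_ \<Rightarrow> real"
    by (rule sum.mono_neutral_left) (use finite_tuples[OF V] that nonneg in \<open>auto simp: order_less_le\<close>)
  have tot: "(\<Sum>xs\<in>?S. q xs) = 1" using total[of r] by (subst S) auto
  then have ne: "?S \<noteq> {}" by (metis sum.empty zero_neq_one)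
  then have c: "card ?S > 0" using fin by (simp add: card_gt_0_iff)
  have "0 \<le> (\<Sum>xs\<in>?S. q xs * ln (q xs / (1 / card ?S)))"
    using relative_entropy_nonneg(1)[of ?S q "\<lambda>_. 1 / card ?S"] fin nonneg tot c by simp
  also have "\<dots> = (\<Sum>xs\<in>?S. q xs * ln (q xs) + q xs * ln (card ?S))"
    using c by (intro sum.cong) (auto simp: ln_mult algebra_simps)
  also have "\<dots> = ln (card ?S) - ent r"
    using tot by (simp add: sum.distrib ent_def S flip: sum_distrib_right)
  finally have "exp (ent r) \<le> exp (ln (card ?S))" by simp
  also have "\<dots> = card ?S" using c by simp
  also have "\<dots> \<le> card D" using D by (intro of_nat_mono card_mono) auto
  finally show ?thesis .
qed

text \<open>Induction on the length: \<open>a # ys\<close> and \<open>b # ys\<close> are shorter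
  than \<open>a # b # ys\<close>, and the equality case of \<open>exp_ent_step\<close> merges them.
  At length \<open>r\<close> this makes every \<open>r\<close>-set of covered vertices an
  edge.\<close>

lemma pos_if_steps_tight:
  assumes tight: "\<And>k. Suc k < r \<Longrightarrow>
      exp (ent (Suc (Suc k)) - ent (Suc k)) + 1 = exp (ent (Suc k) - ent k)"
    and "distinct xs" "length xs \<le> r" "set xs \<subseteq> {a \<in> V. q [a] > 0}"
  shows "q xs > 0"
  using assms(2-)
proof (induction "length xs" arbitrary: xs rule: less_induct)
  case less
  consider "xs = []" | a where "xs = [a]" | a b ys where "xs = a # b # ys"
    by (cases xs; cases "tl xs") auto
  then show ?case
  proof cases
    case 3
    have "q (a # ys) > 0" "q (b # ys) > 0" using less.prems by (intro less.hyps; auto simp: 3)+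
    moreover have "ys \<in> tuples V (length ys)" using less.prems by (auto simp: 3 tuples_def)
    ultimately show ?thesis
      using exp_ent_step(2)[OF _ tight, of "length ys" ys a b] less.prems by (auto simp: 3)
  qed (use less.prems empty in auto)
qed

end

section \<open>Comparison of products along a chain with drops of at least one\<close>

lemma prod_eq_imp_eq:
  fixes f g :: "'i \<Rightarrow> real"
  assumes "finite I" "\<And>i. i \<in> I \<Longrightarrow> 0 < f i" "\<And>i. i \<in> I \<Longrightarrow> f i \<le> g i" "prod f I = prod g I" "i \<in> I"
  shows "f i = g i"
proof (rule ccontr)
  assume "f i \<noteq> g i"
  then have "f i < g i" using assms by force
  moreover have "prod f (I - {i}) \<le> prod g (I - {i})"
    using assms by (intro prod_mono) (auto intro: less_imp_le)
  moreover have "0 < prod f (I - {i})"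
    using assms by (intro prod_pos) auto
  ultimately have "f i * prod f (I - {i}) < g i * prod g (I - {i})"
    using assms by (intro mult_less_le_imp_less) (auto intro: less_imp_le)
  then show False using assms by (simp flip: prod.remove)
qed

lemma chain_prod_bound:
  fixes z :: "nat \<Rightarrow> real" and y :: real
  assumes z: "\<And>k. k \<le> m \<Longrightarrow> z k > 0" "\<And>k. k < m \<Longrightarrow> z (Suc k) + 1 \<le> z k"
    and y: "y > 0" "(\<Prod>k<m. y - 1 - real k) > 0"
    and le: "(\<Prod>k<Suc m. z k) \<le> y * (\<Prod>k<m. y - 1 - real k)"
  shows "(\<Prod>k<m. z (Suc k)) \<le> (\<Prod>k<m. y - 1 - real k)"
    and "\<lbrakk>(\<Prod>k<m. z (Suc k)) = (\<Prod>k<m. y - 1 - real k); k < m\<rbrakk> \<Longrightarrow> z (Suc k) + 1 = z k"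
    and "\<lbrakk>(\<Prod>k<m. z (Suc k)) = (\<Prod>k<m. y - 1 - real k); m > 0\<rbrakk> \<Longrightarrow>
      (\<Prod>k<Suc m. z k) = y * (\<Prod>k<m. y - 1 - real k)"
proof -
  let ?Z = "\<Prod>k<m. z (Suc k)" and ?Y = "\<Prod>k<m. y - 1 - real k"
  have Z_split: "(\<Prod>k<Suc m. z k) = z 0 * ?Z" by (rule prod.lessThan_Suc_shift)
  have Z: "?Z > 0" using z(1) by (intro prod_pos) auto
  \<comment> \<open>If the first factor exceeds \<open>y\<close>, the bound on the full product
    leaves strictly less than \<open>?Y\<close> for the others. Strictness rules this case out under
    equality.\<close>
  have big: "?Z < ?Y" if "z 0 > y"
  proof -
    have "y * ?Z < z 0 * ?Z" using that Z by simp
    then have "y * ?Z < y * ?Y" using le Z_split by simp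
    then show ?thesis using y by simp
  qed
  have small: "z k \<le> y - real k" if "z 0 \<le> y" "k \<le> m" for k
    using that(2)
  proof (induction k)
    case (Suc k)
    then show ?case using z(2)[of k] by simp
  qed (use that in simp)
  have "?Z \<le> ?Y" if "z 0 \<le> y"
  proof (rule prod_mono)
    fix k assume "k \<in> {..<m}"
    then show "0 \<le> z (Suc k) \<and> z (Suc k) \<le> y - 1 - real k"
      using small[OF that, of "Suc k"] z(1)[of "Suc k"] by simp
  qed
  with big show "?Z \<le> ?Y" by (meson less_imp_le not_le)
  have eqs: "z k = y - real k" if eq: "?Z = ?Y" and k: "k \<le> m" "m > 0" for k
  proof -
    have z0: "z 0 \<le> y" using big eq by force
    have S: "z (Suc j) = y - 1 - real j" if "j < m" for j
    proof (rule prod_eq_imp_eq[OF _ _ _ eq])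
      fix i assume "i \<in> {..<m}"
      then show "0 < z (Suc i)" "z (Suc i) \<le> y - 1 - real i"
        using small[OF z0, of "Suc i"] z(1)[of "Suc i"] by auto
    qed (use that in auto)
    show ?thesis
    proof (cases k)
      \<comment> \<open>\<open>z 0\<close> is not a factor of \<open>?Z\<close>. It is squeezed
        between \<open>z 1 + 1 = y\<close> and \<open>y\<close>, which needs
        \<open>m > 0\<close>.\<close>
      case 0
      then show ?thesis using S[of 0] z(2)[of 0] z0 k by simp
    next
      case (Suc j)
      then show ?thesis using S[of j] k by simp
    qed
  qed
  show "z (Suc k) + 1 = z k" if "?Z = ?Y" "k < m"
    using eqs[OF that(1), of k] eqs[OF that(1), of "Suc k"] that by simp
  show "(\<Prod>k<Suc m. z k) = y * ?Y" if "?Z = ?Y" "m > 0"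
    using eqs[OF that(1), of 0] that Z_split by simp
qed

section \<open>The random ordered edge\<close>

text \<open>Here \<open>w e\<close> is the probability of each single ordering of \<open>e\<close>.
  The factorial counts the orderings of an edge containing \<open>xs\<close> that end with
  \<open>xs\<close>.\<close>

definition edge_marginal :: "nat \<Rightarrow> 'a set set \<Rightarrow> ('a set \<Rightarrow> real) \<Rightarrow> 'a list \<Rightarrow> real" where
  "edge_marginal r E w xs =
    (if distinct xs then fact (r - length xs) * (\<Sum>e\<in>E. if set xs \<subseteq> e then w e else 0) else 0)"

lemma uniform_hypergraphD:
  assumes "uniform_hypergraph r V E"
  shows "finite V" "finite E" "e \<in> E \<Longrightarrow> e \<subseteq> V \<and> finite e \<and> card e = r"
  using assms finite_imp_finite_nsets[of V r]
  by (auto simp: uniform_hypergraph_def nsets_def intro: finite_subset)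

lemma exchangeable_edge_marginal:
  assumes H: "uniform_hypergraph r V E" and w: "\<And>e. w e \<ge> 0" "fact r * (\<Sum>e\<in>E. w e) = 1"
  shows "exchangeable_tuples V r (edge_marginal r E w)"
proof
  show "finite V" using uniform_hypergraphD[OF H] by blast
  show "edge_marginal r E w xs \<ge> 0" for xs
    using w by (auto simp: edge_marginal_def intro!: mult_nonneg_nonneg sum_nonneg)
  show "edge_marginal r E w [] = 1" using w by (simp add: edge_marginal_def)
  show "edge_marginal r E w (a # b # xs) = edge_marginal r E w (b # a # xs)" for a b xs
    by (auto simp: edge_marginal_def insert_commute)
  show "edge_marginal r E w (a # a # xs) = 0" for a xs by (simp add: edge_marginal_def)
  fix xs assume xs: "set xs \<subseteq> V" "length xs < r"
  show "(\<Sum>a\<in>V. edge_marginal r E w (a # xs)) = edge_marginal r E w xs"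
  proof (cases "distinct xs")
    case True
    let ?c = "fact (r - Suc (length xs)) :: real"
    have "(\<Sum>a\<in>V. edge_marginal r E w (a # xs)) =
        (\<Sum>a\<in>V. \<Sum>e\<in>E. if a \<notin> set xs \<and> a \<in> e \<and> set xs \<subseteq> e then ?c * w e else 0)"
      using True by (intro sum.cong) (auto simp: edge_marginal_def sum_distrib_left intro!: sum.cong)
    also have "\<dots> = (\<Sum>e\<in>E. \<Sum>a\<in>V. if a \<notin> set xs \<and> a \<in> e \<and> set xs \<subseteq> e then ?c * w e else 0)"
      by (rule sum.swap)
    \<comment> \<open>An edge containing \<open>xs\<close> has \<open>r - length xs\<close> vertices
      left to put in front, and this factor turns \<open>?c\<close> into the next factorial.\<close>
    also have "\<dots> = (\<Sum>e\<in>E. fact (r - length xs) * (if set xs \<subseteq> e then w e else 0))"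
    proof (rule sum.cong)
      fix e assume e: "e \<in> E"
      note eV = uniform_hypergraphD(3)[OF H e]
      show "(\<Sum>a\<in>V. if a \<notin> set xs \<and> a \<in> e \<and> set xs \<subseteq> e then ?c * w e else 0) =
          fact (r - length xs) * (if set xs \<subseteq> e then w e else 0)"
      proof (cases "set xs \<subseteq> e")
        case sub: True
        have "(\<Sum>a\<in>V. if a \<notin> set xs \<and> a \<in> e \<and> set xs \<subseteq> e then ?c * w e else 0) =
            (\<Sum>a\<in>e - set xs. ?c * w e)"
          using eV sub uniform_hypergraphD(1)[OF H] by (intro sum.mono_neutral_cong_right) auto
        also have "\<dots> = real (r - length xs) * ?c * w e"
          using eV sub True by (simp add: card_Diff_subset distinct_card)
        also have "real (r - length xs) * ?c = fact (r - length xs)"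
          using xs by (simp add: fact_reduce[of "r - length xs"])
        finally show ?thesis using sub by simp
      qed (simp cong: conj_cong)
    qed simp
    also have "\<dots> = edge_marginal r E w xs"
      using True by (simp add: edge_marginal_def sum_distrib_left)
    finally show ?thesis .
  qed (simp add: edge_marginal_def)
qed

lemma edge_marginal_full:
  assumes H: "uniform_hypergraph r V E" and xs: "length xs = r"
  shows "edge_marginal r E w xs = (if distinct xs \<and> set xs \<in> E then w (set xs) else 0)"
proof (cases "distinct xs")
  case True
  have "set xs \<subseteq> e \<longleftrightarrow> e = set xs" if "e \<in> E" for e
    using uniform_hypergraphD(3)[OF H that] True xs distinct_card[of xs] card_subset_eq[of e "set xs"] by auto
  then have "(\<Sum>e\<in>E. if set xs \<subseteq> e then w e else 0) = (\<Sum>e\<in>E. if e = set xs then w e else 0)"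
    by (intro sum.cong) auto
  then show ?thesis using True xs uniform_hypergraphD(2)[OF H] by (simp add: edge_marginal_def)
qed (simp add: edge_marginal_def)

lemma sum_orderings:
  fixes g :: "'a set \<Rightarrow> real"
  assumes "finite E" "\<And>e. e \<in> E \<Longrightarrow> finite e \<and> card e = r"
  shows "finite {xs. distinct xs \<and> set xs \<in> E}"
    and "(\<Sum>xs | distinct xs \<and> set xs \<in> E. g (set xs)) = fact r * (\<Sum>e\<in>E. g e)"
proof -
  have eq: "{xs. distinct xs \<and> set xs \<in> E} = (\<Union>e\<in>E. permutations_of_set e)"
    by (auto simp: permutations_of_set_def)
  show "finite {xs. distinct xs \<and> set xs \<in> E}" unfolding eq using assms by simp
  have "(\<Sum>xs\<in>(\<Union>e\<in>E. permutations_of_set e). g (set xs)) =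
      (\<Sum>e\<in>E. \<Sum>xs\<in>permutations_of_set e. g (set xs))"
    using assms(1) by (intro sum.UNION_disjoint) (auto dest: permutations_of_setD)
  also have "\<dots> = (\<Sum>e\<in>E. fact r * g e)"
  proof (rule sum.cong)
    fix e assume e: "e \<in> E"
    have "(\<Sum>xs\<in>permutations_of_set e. g (set xs)) = (\<Sum>xs\<in>permutations_of_set e. g e)"
      by (intro sum.cong) (auto simp: permutations_of_set_def)
    then show "(\<Sum>xs\<in>permutations_of_set e. g (set xs)) = fact r * g e"
      using assms(2)[OF e] by simp
  qed simp
  finally show "(\<Sum>xs | distinct xs \<and> set xs \<in> E. g (set xs)) = fact r * (\<Sum>e\<in>E. g e)"
    by (simp add: eq sum_distrib_left)
qed

section \<open>The upper bound for nonnegative vectors\<close>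

lemma p_inv_props:
  assumes "r \<ge> 1" "y \<ge> 0"
  shows "p_inv r y \<ge> real r - 1" "p_inv r y gchoose r = y"
proof -
  note b = bij_betw_gchoose[OF assms(1)]
  have "p_inv r y \<in> {real r - 1..}"
    unfolding p_inv_def using b assms(2)
    by (intro the_inv_into_into) (auto simp: bij_betw_def)
  then show "p_inv r y \<ge> real r - 1" by simp
  show "p_inv r y gchoose r = y"
    unfolding p_inv_def using f_the_inv_into_f_bij_betw[OF b, of y] assms(2) by simp
qed

lemma edge_form_nonneg_bound:
  assumes H: "uniform_hypergraph r V E" and r: "r \<ge> 2"
    and x: "\<And>i. x i \<ge> 0" "(\<Sum>i\<in>V. x i ^ r) = 1" and pos: "edge_form r E x > 0"
  shows "edge_form r E x \<le> f_fun r (real (card E))"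
    and "edge_form r E x = f_fun r (real (card E)) \<Longrightarrow> \<exists>S\<subseteq>V. E = [S]\<^bsup>r\<^esup>"
proof -
  note HD = uniform_hypergraphD[OF H]
  define m where "m = r - 1"
  have rm: "r = Suc m" and m: "m > 0" using r by (auto simp: m_def)
  \<comment> \<open>\<open>P\<close> sums the products of entries over all ordered edges. Its
    positivity allows the normalisation in \<open>w\<close>.\<close>
  define P where "P = fact r * (\<Sum>e\<in>E. \<Prod>i\<in>e. x i)"
  have P_eq: "P = fact m * edge_form r E x" by (simp add: P_def rm edge_form_def)
  have P: "P > 0" using pos by (simp add: P_eq)
  define w where "w e = (\<Prod>i\<in>e. x i) / P" for e
  define q where "q = edge_marginal r E w"
  have w0: "w e \<ge> 0" for e using x P by (simp add: w_def prod_nonneg)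
  have w1: "fact r * (\<Sum>e\<in>E. w e) = 1"
    using P by (simp add: w_def flip: sum_divide_distrib) (simp add: P_def)
  interpret exchangeable_tuples V r q
    unfolding q_def by (rule exchangeable_edge_marginal[OF H w0 w1])
  have q1: "q [a] = fact m * (\<Sum>e\<in>E. if a \<in> e then w e else 0)" for a
    by (simp add: q_def edge_marginal_def rm)
  have qr: "q xs = (if distinct xs \<and> set xs \<in> E then w (set xs) else 0)" if "length xs = r" for xs
    unfolding q_def using edge_marginal_full[OF H that] .
  have ent1: "ent (Suc 0) = - (\<Sum>a\<in>V. q [a] * ln (q [a]))"
    by (simp add: ent_def sum_tuples_Suc[OF V])
  have len: "length xs = r \<and> set xs \<subseteq> V" if "distinct xs" "set xs \<in> E" for xs
    using HD(3)[OF that(2)] distinct_card[OF that(1)] by simp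
  have xpos: "x a > 0" if "w e > 0" "e \<in> E" "a \<in> e" for a e
  proof -
    have "(\<Prod>i\<in>e. x i) \<noteq> 0" using that by (auto simp: w_def)
    then have "x a \<noteq> 0" using that HD(3) by (auto simp: prod_zero_iff)
    then show ?thesis using x(1)[of a] by simp
  qed
  \<comment> \<open>Since \<open>ln (w e)\<close> is the sum of \<open>ln (x i)\<close> over
    \<open>e\<close> minus \<open>ln P\<close>, the entropy is \<open>ln P\<close> minus an expected
    sum of \<open>r\<close> logarithms. Each coordinate has law \<open>q [i]\<close>, which gives
    the factor \<open>r\<close> in \<open>entr\<close>.\<close>
  have "ent r = - (\<Sum>xs | distinct xs \<and> set xs \<in> E. w (set xs) * ln (w (set xs)))"
    unfolding ent_def
    by (rule arg_cong[of _ _ uminus], rule sum.mono_neutral_cong_right)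
      (use finite_tuples[OF V] len in \<open>auto simp: tuples_def qr\<close>)
  also have "\<dots> = - (fact r * (\<Sum>e\<in>E. w e * ln (w e)))"
    using HD by (subst sum_orderings(2)) auto
  also have "(\<Sum>e\<in>E. w e * ln (w e)) = (\<Sum>e\<in>E. (\<Sum>i\<in>V. (if i \<in> e then w e else 0) * ln (x i)) - w e * ln P)"
  proof (rule sum.cong)
    fix e assume e: "e \<in> E"
    have "w e * ln (w e) = w e * (\<Sum>i\<in>e. ln (x i)) - w e * ln P"
    proof (cases "w e = 0")
      case False
      then have we: "w e > 0" using w0[of e] by simp
      have "ln (\<Prod>i\<in>e. x i) = (\<Sum>i\<in>e. ln (x i))"
        using HD(3)[OF e] xpos[OF we e] by (intro ln_prod) (metis, metis less_irrefl)
      moreover have "(\<Prod>i\<in>e. x i) > 0" using xpos[OF we e] by (intro prod_pos) auto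
      ultimately have "ln (w e) = (\<Sum>i\<in>e. ln (x i)) - ln P" using P by (simp add: w_def ln_div)
      then show ?thesis by (simp add: right_diff_distrib)
    qed simp
    also have "w e * (\<Sum>i\<in>e. ln (x i)) = (\<Sum>i\<in>V. (if i \<in> e then w e else 0) * ln (x i))"
      unfolding sum_distrib_left
      using HD(3)[OF e] HD(1) by (intro sum.mono_neutral_cong_left) auto
    finally show "w e * ln (w e) = (\<Sum>i\<in>V. (if i \<in> e then w e else 0) * ln (x i)) - w e * ln P" .
  qed simp
  also have "\<dots> = (\<Sum>i\<in>V. (\<Sum>e\<in>E. if i \<in> e then w e else 0) * ln (x i)) - (\<Sum>e\<in>E. w e) * ln P"
    unfolding sum_subtractf sum_distrib_right by (subst sum.swap) simp
  also have "fact r * \<dots> = (\<Sum>i\<in>V. real r * q [i] * ln (x i)) - ln P"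
  proof -
    have "fact r * (\<Sum>i\<in>V. (\<Sum>e\<in>E. if i \<in> e then w e else 0) * ln (x i)) =
        (\<Sum>i\<in>V. fact r * ((\<Sum>e\<in>E. if i \<in> e then w e else 0) * ln (x i)))"
      by (rule sum_distrib_left)
    also have "\<dots> = (\<Sum>i\<in>V. real r * q [i] * ln (x i))"
      by (intro sum.cong) (simp_all add: q1 rm)
    moreover have "fact r * ((\<Sum>e\<in>E. w e) * ln P) = ln P"
      using w1 by (simp flip: mult.assoc)
    ultimately show ?thesis by (simp only: right_diff_distrib)
  qed
  finally have entr: "ent r = ln P - (\<Sum>i\<in>V. real r * q [i] * ln (x i))" by simp
  have xq: "x a > 0" if "a \<in> V" "q [a] > 0" for a
  proof -
    have "\<exists>e\<in>E. a \<in> e \<and> w e \<noteq> 0"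
    proof (rule ccontr)
      assume "\<not> ?thesis"
      then have "q [a] = 0" unfolding q1 by (auto intro!: sum.neutral)
      then show False using that by simp
    qed
    then show ?thesis using xpos w0 by (metis order_less_le)
  qed
  have "(\<Sum>a\<in>V. q [a]) = 1" using total[of "Suc 0"] r by (simp add: sum_tuples_Suc[OF V])
  \<comment> \<open>The norm condition makes \<open>x a ^ r\<close> a probability distribution on
    \<open>V\<close>; Gibbs' inequality compares the law of a single vertex with it.\<close>
  then have "0 \<le> (\<Sum>a\<in>V. q [a] * ln (q [a] / x a ^ r))"
    using V nonneg x xq by (intro relative_entropy_nonneg(1)) auto
  also have "\<dots> = (\<Sum>a\<in>V. q [a] * ln (q [a]) - real r * q [a] * ln (x a))"
  proof (rule sum.cong)
    fix a assume a: "a \<in> V"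
    show "q [a] * ln (q [a] / x a ^ r) = q [a] * ln (q [a]) - real r * q [a] * ln (x a)"
    proof (cases "q [a] = 0")
      case False
      then have "q [a] > 0" using nonneg[of "[a]"] by simp
      then show ?thesis using xq[OF a] by (simp add: ln_div ln_realpow algebra_simps)
    qed simp
  qed simp
  also have "\<dots> = ent r - ent (Suc 0) - ln P" by (simp add: entr ent1 sum_subtractf)
  finally have "exp (ln P) \<le> exp (ent r - ent (Suc 0))" by simp
  then have P_le: "P \<le> exp (ent r - ent (Suc 0))" using P by simp

  \<comment> \<open>Counting only edges of positive weight sharpens the entropy bound, so that
    equality can later exclude edges of weight zero.\<close>
  define E' where "E' = {e \<in> E. w e > 0}"
  have E': "E' \<subseteq> E" "finite E'" "card E' \<le> card E" using HD(2) by (auto simp: E'_def card_mono)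
  have "exp (ent r) \<le> real (card {xs. distinct xs \<and> set xs \<in> E'})"
    using HD(3) E' by (intro exp_ent_le_card sum_orderings(1)) (auto simp: tuples_def qr E'_def split: if_splits)
  also have "\<dots> = fact r * real (card E')"
    using sum_orderings(2)[of E' r "\<lambda>_. 1"] E' HD(3) by auto
  finally have ent_le: "exp (ent r) \<le> fact r * real (card E')" .

  \<comment> \<open>With this \<open>y\<close>, the number of ordered edges is
    \<open>y * ?Y\<close>, while \<open>?Y\<close> is \<open>fact m\<close> times the claimed
    bound.\<close>
  define y where "y = p_inv r (card E)"
  define z where "z k = exp (ent (Suc k) - ent k)" for k
  let ?Y = "\<Prod>k<m. y - 1 - real k"
  have y: "y \<ge> real m" "y gchoose r = card E" using p_inv_props[of r "card E"] r by (auto simp: y_def rm)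
  have yY: "y * ?Y = fact r * real (card E)"
  proof -
    have "fact r * real (card E) = (\<Prod>k<Suc m. y - real k)"
      unfolding y(2)[symmetric] gbinomial_mult_fact rm atLeast0LessThan ..
    also have "\<dots> = y * ?Y" by (simp add: prod.lessThan_Suc_shift diff_diff_eq del: prod.lessThan_Suc)
    finally show ?thesis by simp
  qed
  have fY: "fact m * f_fun r (card E) = ?Y"
    unfolding f_fun_def y_def[symmetric] m_def[symmetric] gbinomial_mult_fact by (simp add: atLeast0LessThan)
  have "E \<noteq> {}" using pos by (auto simp: edge_form_def)
  then have "card E > 0" using HD(2) by (simp add: card_gt_0_iff)
  then have "y * ?Y > 0" unfolding yY by simp
  moreover have y0: "y > 0" using y(1) m by simp
  ultimately have Y0: "?Y > 0" by (simp add: zero_less_mult_iff)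
  have zpos: "z k > 0" for k by (simp add: z_def)
  have zstep: "z (Suc k) + 1 \<le> z k" if "k < m" for k
    unfolding z_def using exp_ent_step(1)[of k] that by (simp add: rm)
  have zr: "(\<Prod>k<Suc m. z k) = exp (ent r)"
    unfolding z_def rm exp_ent_eq_prod ..
  have "(\<Prod>k<Suc m. z k) = z 0 * (\<Prod>k<m. z (Suc k))" by (rule prod.lessThan_Suc_shift)
  moreover have "z 0 = exp (ent (Suc 0))" using exp_ent_eq_prod[of "Suc 0"] by (simp add: z_def)
  ultimately have zZ: "(\<Prod>k<m. z (Suc k)) = exp (ent r - ent (Suc 0))"
    using zr by (simp add: exp_diff field_simps)
  have zle: "(\<Prod>k<Suc m. z k) \<le> y * ?Y"
    unfolding zr yY using ent_le E'(3) by (meson fact_ge_zero mult_left_mono of_nat_mono order_trans)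
  note chain = chain_prod_bound[of m z, OF zpos zstep y0 Y0 zle]
  have "fact m * edge_form r E x \<le> fact m * f_fun r (card E)"
    using P_le chain(1) unfolding zZ P_eq fY by simp
  then show "edge_form r E x \<le> f_fun r (real (card E))" by simp
  assume "edge_form r E x = f_fun r (real (card E))"
  then have Zeq: "(\<Prod>k<m. z (Suc k)) = ?Y"
    using P_le chain(1) unfolding zZ P_eq fY[symmetric] by simp
  have tight: "exp (ent (Suc (Suc k)) - ent (Suc k)) + 1 = exp (ent (Suc k) - ent k)" if "Suc k < r" for k
    using chain(2)[OF _ Zeq, of k] that by (simp add: z_def rm)
  have "fact r * real (card E) \<le> fact r * real (card E')"
    using chain(3)[OF _ Zeq m] ent_le unfolding zr yY by simp
  then have "E' = E" using E' HD(2) by (intro card_subset_eq) auto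
  then have wpos: "w e > 0" if "e \<in> E" for e using that by (auto simp: E'_def)
  \<comment> \<open>All weights are now positive, so \<open>S\<close> is the set of vertices covered
    by edges.\<close>
  define S where "S = {a \<in> V. q [a] > 0}"
  have "e \<in> [S]\<^bsup>r\<^esup>" if e: "e \<in> E" for e
  proof -
    have "q [a] > 0" if a: "a \<in> e" for a
    proof -
      have "w e \<le> (\<Sum>e\<in>E. if a \<in> e then w e else 0)"
        using member_le_sum[of e E "\<lambda>e. if a \<in> e then w e else 0"] e a HD(2) w0 by auto
      then show ?thesis using wpos[OF e] by (simp add: q1)
    qed
    then show ?thesis using HD(3)[OF e] by (auto simp: nsets_def S_def)
  qed
  moreover have "e \<in> E" if e: "e \<in> [S]\<^bsup>r\<^esup>" for e
  proof -
    obtain xs where xs: "set xs = e" "distinct xs" using e finite_distinct_list by (auto simp: nsets_def)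
    then have len_xs: "length xs = r" using e distinct_card[of xs] by (auto simp: nsets_def)
    have "q xs > 0" using e xs len_xs by (intro pos_if_steps_tight[OF tight]) (auto simp: nsets_def S_def)
    then show ?thesis using qr[OF len_xs] xs by (auto split: if_splits)
  qed
  ultimately show "\<exists>S\<subseteq>V. E = [S]\<^bsup>r\<^esup>" by (intro exI[of _ S]) (auto simp: S_def)
qed

section \<open>The average degree as a lower bound, and the theorem\<close>

text \<open>The test vector is constant on \<open>S\<close> and zero elsewhere. Taking
  \<open>S = V\<close> shows that the radius is positive if there are edges; taking the vertex set
  of a complete hypergraph shows that the bound is attained.\<close>

lemma hyp_spectral_radius_ge_average:
  assumes H: "uniform_hypergraph r V E" and r: "r \<ge> 1"
    and S: "S \<subseteq> V" "S \<noteq> {}" "\<And>e. e \<in> E \<Longrightarrow> e \<subseteq> S"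
  shows "real r * real (card E) / real (card S) \<le> hyp_spectral_radius r V E"
proof -
  note HD = uniform_hypergraphD[OF H]
  have fS: "finite S" using S HD(1) finite_subset by blast
  then have cS: "card S > 0" using S by (simp add: card_gt_0_iff)
  define c where "c = root r (1 / card S)"
  have c: "c ^ r = 1 / card S" "c \<ge> 0" using r by (auto simp: c_def)
  define x where "x i = (if i \<in> S then c else 0)" for i
  have "(\<Sum>i\<in>V. \<bar>x i\<bar> ^ r) = (\<Sum>i\<in>S. c ^ r)"
    using HD(1) S r c by (intro sum.mono_neutral_cong_right) (auto simp: x_def)
  also have "\<dots> = 1" using c cS by simp
  finally have "lnorm r V x = 1" using r by (simp add: lnorm_def)
  then have "edge_form r E x \<le> hyp_spectral_radius r V E"
    using hyp_spectral_radius_attained(2)[OF H _ r] S by blast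
  moreover have "(\<Prod>i\<in>e. x i) = 1 / card S" if "e \<in> E" for e
  proof -
    have "(\<Prod>i\<in>e. x i) = (\<Prod>i\<in>e. c)" using S(3)[OF that] by (intro prod.cong) (auto simp: x_def)
    then show ?thesis using HD(3)[OF that] c by simp
  qed
  then have "edge_form r E x = real r * real (card E) / real (card S)" by (simp add: edge_form_def)
  ultimately show ?thesis by simp
qed

theorem theorem1p2:
  fixes r e :: nat and V :: "'a set" and E :: "'a set set"
  assumes "r \<ge> 2"
    and "uniform_hypergraph r V E"
    and "V \<noteq> {}"
    and "card E = e"
  shows "hyp_spectral_radius r V E \<le> f_fun r (real e) \<and>
    (hyp_spectral_radius r V E = f_fun r (real e) \<longleftrightarrow>
      (\<exists>k::nat. e = k choose r \<and> complete_with_isolated r k V E))"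
proof -
  note H = assms(2) and HD = uniform_hypergraphD[OF assms(2)]
  let ?\<rho> = "hyp_spectral_radius r V E"
  have r1: "r \<ge> 1" using assms(1) by simp
  note att = hyp_spectral_radius_attained[OF H assms(3) r1]
  obtain x where x: "lnorm r V x = 1" "?\<rho> = edge_form r E x" using att(1) by blast
  show ?thesis
  proof (cases "E = {}")
    case True
    \<comment> \<open>To evaluate \<open>f_fun r 0\<close>, write 0 as
      \<open>r - 1 choose r\<close>, the binomial coefficient at the left end of the range of
      \<open>p_inv\<close>.\<close>
    have "f_fun r (real (r - 1 choose r)) = real ((r - 1 - 1) choose (r - 1))"
      using assms(1) by (intro f_fun_binomial) auto
    then have "f_fun r 0 = 0" using assms(1) by (simp add: binomial_eq_0)
    moreover have "?\<rho> = 0" using x True by (simp add: edge_form_def)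
    moreover have "complete_with_isolated r 0 V E"
      using True assms(1) by (auto simp: complete_with_isolated_def nsets_def)
    moreover have "e = 0 choose r" using True assms by (simp add: binomial_eq_0)
    moreover have "e = 0" using True assms(4) by simp
    ultimately show ?thesis by auto
  next
    case False
    then have e0: "e > 0" using assms(4) HD(2) by (auto simp: card_gt_0_iff)
    have "0 < real r * real (card E) / real (card V)"
      using e0 assms HD(1) by (simp add: card_gt_0_iff)
    also have "\<dots> \<le> ?\<rho>"
      using HD(3) assms by (intro hyp_spectral_radius_ge_average[OF H r1]) auto
    finally have pos: "?\<rho> > 0" .
    let ?x = "\<lambda>i. \<bar>x i\<bar>"
    have n1: "lnorm r V ?x = 1" using x(1) by (simp add: lnorm_def)
    \<comment> \<open>Taking absolute values keeps the norm and does not decrease the form, so the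
      new vector is also a maximiser.\<close>
    have "edge_form r E x \<le> edge_form r E ?x"
      unfolding edge_form_def
      by (intro mult_left_mono sum_mono) (auto simp: abs_le_iff simp flip: abs_prod)
    then have eq: "edge_form r E ?x = ?\<rho>" using x(2) att(2)[OF n1] by simp
    have s1: "(\<Sum>i\<in>V. ?x i ^ r) = 1" using n1 r1 by (simp add: lnorm_def)
    note bound = edge_form_nonneg_bound[OF H assms(1), of ?x, OF _ s1, unfolded eq assms(4)]
    have le: "?\<rho> \<le> f_fun r (real e)" using bound(1) pos by simp
    have "\<exists>k. e = k choose r \<and> complete_with_isolated r k V E" if eq_f: "?\<rho> = f_fun r (real e)"
    proof -
      obtain S where S: "S \<subseteq> V" "E = [S]\<^bsup>r\<^esup>" using bound(2) pos eq_f by auto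
      moreover have "finite S" using S(1) HD(1) finite_subset by blast
      ultimately have "card E = card S choose r" by (simp add: card_nsets)
      then show ?thesis using S assms(4) by (auto simp: complete_with_isolated_def)
    qed
    moreover have "f_fun r (real e) \<le> ?\<rho>" if e_k: "e = k choose r" and comp: "complete_with_isolated r k V E" for k
    proof -
      obtain S where S: "S \<subseteq> V" "card S = k" "E = [S]\<^bsup>r\<^esup>"
        using comp by (auto simp: complete_with_isolated_def)
      have k: "k \<ge> r" using e0 e_k by (simp add: zero_less_binomial_iff)
      \<comment> \<open>Double counting of vertex-edge incidences: the average degree on
        \<open>S\<close> is \<open>k - 1 choose (r - 1)\<close>, exactly the value of
        \<open>f_fun\<close> at \<open>e\<close>.\<close>
      have "r * e = k * (k - 1 choose (r - 1))"
        using times_binomial_minus1_eq[of r k] r1 e_k by simp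
      then have "real r * real e = real k * real (k - 1 choose (r - 1))" by (metis of_nat_mult)
      then have "real (k - 1 choose (r - 1)) = real r * real (card E) / real (card S)"
        using k r1 assms(4) S(2) by simp
      also have "\<dots> \<le> ?\<rho>"
        using S k r1 by (intro hyp_spectral_radius_ge_average[OF H r1]) (auto simp: nsets_def)
      finally show ?thesis using f_fun_binomial[OF assms(1), of k] k e_k by simp
    qed
    ultimately show ?thesis using le by (metis antisym)
  qed
qed

end
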